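(* Let $L, R$ be non-empty subsets of a group $G$, and let $\Gamma=\mathrm{2SCay}(G;L,R)$. Then $\mathrm{Aut}(\Gamma)$ contains $$K:=\{\lambda_{x,y} : x\in N_G(L),\ y\in N_G(R)\}$$ and $N_{\mathrm{Aut}(G)}(L)\cap N_{\mathrm{Aut}(G)}(R)$. In particular, $K$ acts vertex-transitively on $\Gamma$ if and only if $G=N_G(L)N_G(R)$.
   Context: For $x,y$ in a group $G$, $\lambda_{x,y}$ denotes the permutation $g\mapsto x^{-1}gy$ of $G$. For a subset $H\subseteq G$, $N_G(H)=\{g\in G: Hg=gH\}$, and $N_{\mathrm{Aut}(G)}(H)=\{\sigma\in\mathrm{Aut}(G): H^\sigma=H\}$, where $H^\sigma$ is the image of $H$ under $\sigma$. Products of subsets are $XY=\{xy: x\in X,y\in Y\}$. For non-empty subsets $L,R$ of $G$, the two-sided Cayley graph $\mathrm{2SCay}(G;L,R)$ is the directed graph with vertex set $G$ with an arc from $x$ to $y$ if and only if $y=\ell^{-1}xr$ for some $\ell\in L$, $r\in R$. $\mathrm{Aut}(\Gamma)$ is the group of permutations of $G$ preserving the arc relation. *)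

theory Defs
  imports "HOL-Algebra.Group_Action" "Graph_Theory.Pair_Digraph"
begin

text \<open>
  Permutations of a carrier set are members of \<^const>\<open>Bij\<close>, i.e. bijections that are
  \<^const>\<open>undefined\<close> off the set, as in the library's \<^const>\<open>BijGroup\<close> and \<^const>\<open>auto\<close>.
\<close>

definition translation :: "('a, 'b) monoid_scheme \<Rightarrow> 'a \<Rightarrow> 'a \<Rightarrow> 'a \<Rightarrow> 'a" where
  "translation G x y = (\<lambda>g \<in> carrier G. inv\<^bsub>G\<^esub> x \<otimes>\<^bsub>G\<^esub> g \<otimes>\<^bsub>G\<^esub> y)"

definition set_normalizer :: "('a, 'b) monoid_scheme \<Rightarrow> 'a set \<Rightarrow> 'a set" where
  "set_normalizer G H = {g \<in> carrier G. H #>\<^bsub>G\<^esub> g = g <#\<^bsub>G\<^esub> H}"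

definition aut_normalizer :: "('a, 'b) monoid_scheme \<Rightarrow> 'a set \<Rightarrow> ('a \<Rightarrow> 'a) set" where
  "aut_normalizer G H = {\<sigma> \<in> auto G. \<sigma> ` H = H}"

definition two_sided_cayley :: "('a, 'b) monoid_scheme \<Rightarrow> 'a set \<Rightarrow> 'a set \<Rightarrow> 'a pair_pre_digraph" where
  "two_sided_cayley G L R =
     \<lparr> pverts = carrier G,
       parcs = {(x, y). x \<in> carrier G \<and> y \<in> carrier G \<and>
                 (\<exists>l \<in> L. \<exists>r \<in> R. y = inv\<^bsub>G\<^esub> l \<otimes>\<^bsub>G\<^esub> x \<otimes>\<^bsub>G\<^esub> r)} \<rparr>"

text \<open>
  The arc relation is required to be preserved in both directions: for infinite digraphs the
  permutations mapping arcs to arcs need not be closed under inverses.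
\<close>

definition digraph_auts :: "'a pair_pre_digraph \<Rightarrow> ('a \<Rightarrow> 'a) set" where
  "digraph_auts \<Gamma> = {\<sigma> \<in> Bij (pverts \<Gamma>).
     \<forall>x \<in> pverts \<Gamma>. \<forall>y \<in> pverts \<Gamma>. (x, y) \<in> parcs \<Gamma> \<longleftrightarrow> (\<sigma> x, \<sigma> y) \<in> parcs \<Gamma>}"

definition digraph_aut_group :: "'a pair_pre_digraph \<Rightarrow> ('a \<Rightarrow> 'a) monoid" where
  "digraph_aut_group \<Gamma> = BijGroup (pverts \<Gamma>) \<lparr>carrier := digraph_auts \<Gamma>\<rparr>"

definition normalizer_translations ::
  "('a, 'b) monoid_scheme \<Rightarrow> 'a set \<Rightarrow> 'a set \<Rightarrow> ('a \<Rightarrow> 'a) set" where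
  "normalizer_translations G L R =
     {translation G x y | x y. x \<in> set_normalizer G L \<and> y \<in> set_normalizer G R}"

text \<open>
  A set of automorphisms acts vertex-transitively if it forms a group under composition whose
  natural action on the vertices is transitive.
\<close>

definition acts_vertex_transitively :: "('a \<Rightarrow> 'a) set \<Rightarrow> 'a pair_pre_digraph \<Rightarrow> bool" where
  "acts_vertex_transitively K \<Gamma> \<longleftrightarrow>
     transitive_action (digraph_aut_group \<Gamma> \<lparr>carrier := K\<rparr>) (pverts \<Gamma>) (\<lambda>\<sigma>. \<sigma>)"

lemma subgroup_digraph_auts: "subgroup (digraph_auts \<Gamma>) (BijGroup (pverts \<Gamma>))"
proof (rule group.subgroupI[OF group_BijGroup])
  show "digraph_auts \<Gamma> \<subseteq> carrier (BijGroup (pverts \<Gamma>))"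
    by (auto simp: digraph_auts_def BijGroup_def)
  have "(\<lambda>x\<in>pverts \<Gamma>. x) \<in> digraph_auts \<Gamma>"
    by (simp add: digraph_auts_def id_Bij)
  then show "digraph_auts \<Gamma> \<noteq> {}" by blast
next
  fix \<sigma> assume s: "\<sigma> \<in> digraph_auts \<Gamma>"
  then have b: "\<sigma> \<in> Bij (pverts \<Gamma>)" by (simp add: digraph_auts_def)
  then have f: "\<sigma> (inv_into (pverts \<Gamma>) \<sigma> x) = x" if "x \<in> pverts \<Gamma>" for x
    using that by (simp add: Bij_def bij_betw_def f_inv_into_f)
  show "inv\<^bsub>BijGroup (pverts \<Gamma>)\<^esub> \<sigma> \<in> digraph_auts \<Gamma>"
    using s b f Bij_inv_into_mem[OF b]
    by (simp add: inv_BijGroup digraph_auts_def restrict_inv_into_Bij)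
next
  fix \<sigma> \<tau> assume "\<sigma> \<in> digraph_auts \<Gamma>" "\<tau> \<in> digraph_auts \<Gamma>"
  then show "\<sigma> \<otimes>\<^bsub>BijGroup (pverts \<Gamma>)\<^esub> \<tau> \<in> digraph_auts \<Gamma>"
    using Bij_imp_funcset[of \<tau> "pverts \<Gamma>"]
    by (auto simp: BijGroup_def digraph_auts_def compose_Bij compose_eq Pi_iff)
qed

lemma group_digraph_aut_group: "group (digraph_aut_group \<Gamma>)"
  unfolding digraph_aut_group_def
  by (rule subgroup.subgroup_is_group[OF subgroup_digraph_auts group_BijGroup])

end

theory Submission
  imports Defs
begin

text \<open>
  An arc \<open>(u, v)\<close> of the two-sided Cayley graph has \<open>v = l\<inverse>ur\<close>. The translation by \<open>x\<close> and \<open>y\<close>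
  carries \<open>v\<close> to \<open>x\<inverse>vy = (x\<inverse>lx)\<inverse>(x\<inverse>uy)(y\<inverse>ry)\<close>, and an automorphism \<open>\<sigma>\<close> carries it to
  \<open>\<sigma>(l)\<inverse>\<sigma>(u)\<sigma>(r)\<close>; so both kinds of map send arcs to arcs as soon as the connection sets \<open>L\<close> and
  \<open>R\<close> are preserved by the conjugations, respectively by \<open>\<sigma>\<close>. Since each kind forms a group of
  permutations, the inverses send arcs to arcs as well, and this is the converse implication in
  the definition of a digraph automorphism (\<open>subgroup_digraph_aut_groupI\<close>).

  A group of automorphisms is transitive as soon as the orbit of one vertex is everything. The
  orbit of \<open>\<one>\<close> under the normalizer translations consists of the elements \<open>x\<inverse>y\<close>, and it is the
  product of the two normalizers because a normalizer is closed under inverses.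
\<close>

section \<open>Groups of digraph automorphisms\<close>

text \<open>
  A single permutation that maps arcs to arcs need not be an automorphism of an infinite digraph;
  within a group of such permutations the inverse supplies the other direction.
\<close>

lemma subgroup_digraph_aut_groupI:
  assumes K: "subgroup K (BijGroup (pverts \<Gamma>))"
    and arcs: "\<And>\<sigma> u v. \<sigma> \<in> K \<Longrightarrow> u \<in> pverts \<Gamma> \<Longrightarrow> v \<in> pverts \<Gamma> \<Longrightarrow>
                 (u, v) \<in> parcs \<Gamma> \<Longrightarrow> (\<sigma> u, \<sigma> v) \<in> parcs \<Gamma>"
  shows "subgroup K (digraph_aut_group \<Gamma>)"
proof -
  have "\<sigma> \<in> digraph_auts \<Gamma>" if s: "\<sigma> \<in> K" for \<sigma>
  proof -
    let ?\<tau> = "inv\<^bsub>BijGroup (pverts \<Gamma>)\<^esub> \<sigma>"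
    have b: "\<sigma> \<in> Bij (pverts \<Gamma>)"
      using subgroup.mem_carrier[OF K s] by (simp add: BijGroup_def)
    have t: "?\<tau> \<in> K"
      using subgroup.m_inv_closed[OF K s] .
    have ts: "?\<tau> (\<sigma> u) = u" and su: "\<sigma> u \<in> pverts \<Gamma>" if "u \<in> pverts \<Gamma>" for u
      using b that Bij_imp_funcset[OF b]
      by (auto simp: inv_BijGroup Bij_def bij_betw_def)
    have "(u, v) \<in> parcs \<Gamma>"
      if "u \<in> pverts \<Gamma>" "v \<in> pverts \<Gamma>" "(\<sigma> u, \<sigma> v) \<in> parcs \<Gamma>" for u v
      using arcs[OF t su su that(3)] that(1,2) ts by simp
    then show ?thesis
      using b arcs[OF s] by (auto simp: digraph_auts_def)
  qed
  then show ?thesis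
    unfolding digraph_aut_group_def
    by (intro group.subgroup_incl[OF group_BijGroup K subgroup_digraph_auts]) blast
qed

lemma BijGroup_mult_apply:
  "\<lbrakk>\<tau> \<in> Bij S; \<sigma> \<in> Bij S; u \<in> S\<rbrakk> \<Longrightarrow> (\<tau> \<otimes>\<^bsub>BijGroup S\<^esub> \<sigma>) u = \<tau> (\<sigma> u)"
  by (simp add: BijGroup_def compose_eq)

lemma acts_vertex_transitively_iff_orbit:
  assumes K: "subgroup K (digraph_aut_group \<Gamma>)" and v: "v \<in> pverts \<Gamma>"
  shows "acts_vertex_transitively K \<Gamma> \<longleftrightarrow> (\<forall>w \<in> pverts \<Gamma>. \<exists>\<sigma> \<in> K. \<sigma> v = w)"
proof
  assume "acts_vertex_transitively K \<Gamma>"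
  then have t: "transitive_action (digraph_aut_group \<Gamma> \<lparr>carrier := K\<rparr>) (pverts \<Gamma>) (\<lambda>\<sigma>. \<sigma>)"
    unfolding acts_vertex_transitively_def .
  show "\<forall>w \<in> pverts \<Gamma>. \<exists>\<sigma> \<in> K. \<sigma> v = w"
    using transitive_action.unique_orbit[OF t v] by simp
next
  assume orbit: "\<forall>w \<in> pverts \<Gamma>. \<exists>\<sigma> \<in> K. \<sigma> v = w"
  let ?B = "BijGroup (pverts \<Gamma>)"
  have K': "subgroup K ?B"
    using group.incl_subgroup[OF group_BijGroup subgroup_digraph_auts] K
    unfolding digraph_aut_group_def by blast
  have "group_hom (?B \<lparr>carrier := K\<rparr>) ?B (\<lambda>\<sigma>. \<sigma>)"
    using group.canonical_inj_is_hom[OF group_BijGroup K'] by (simp add: id_def)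
  then have act: "group_action (digraph_aut_group \<Gamma> \<lparr>carrier := K\<rparr>) (pverts \<Gamma>) (\<lambda>\<sigma>. \<sigma>)"
    by (simp add: group_action_def digraph_aut_group_def)
  have "\<exists>\<rho> \<in> K. \<rho> u = w" if u: "u \<in> pverts \<Gamma>" and w: "w \<in> pverts \<Gamma>" for u w
  proof -
    \<comment> \<open>Pass through the base point: back from \<open>u\<close> to \<open>v\<close>, then on to \<open>w\<close>.\<close>
    obtain \<sigma> \<tau> where s: "\<sigma> \<in> K" "\<sigma> v = u" and t: "\<tau> \<in> K" "\<tau> v = w"
      using orbit u w by blast
    have b: "\<sigma> \<in> Bij (pverts \<Gamma>)" "\<tau> \<in> Bij (pverts \<Gamma>)"
      using subgroup.mem_carrier[OF K'] s t by (auto simp: BijGroup_def)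
    have "(inv\<^bsub>?B\<^esub> \<sigma>) u = v"
      using b(1) s(2) u v by (auto simp: inv_BijGroup Bij_def bij_betw_def)
    moreover have "inv\<^bsub>?B\<^esub> \<sigma> \<in> Bij (pverts \<Gamma>)"
      using b(1) by (simp add: inv_BijGroup restrict_inv_into_Bij)
    ultimately have "(\<tau> \<otimes>\<^bsub>?B\<^esub> inv\<^bsub>?B\<^esub> \<sigma>) u = w"
      using b(2) t(2) u by (simp add: BijGroup_mult_apply)
    moreover have "\<tau> \<otimes>\<^bsub>?B\<^esub> inv\<^bsub>?B\<^esub> \<sigma> \<in> K"
      using K' s t by (simp add: subgroup.m_closed subgroup.m_inv_closed)
    ultimately show ?thesis by blast
  qed
  then show "acts_vertex_transitively K \<Gamma>"
    unfolding acts_vertex_transitively_def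
    by (intro transitive_action.intro act) (simp add: transitive_action_axioms_def)
qed

section \<open>Normalizers of subsets\<close>

context group
begin

lemma set_normalizer_iff_conjugate:
  assumes H: "H \<subseteq> carrier G" and g: "g \<in> carrier G"
  shows "g \<in> set_normalizer G H \<longleftrightarrow> g <#\<^bsub>G\<^esub> H #> inv g = H"
proof -
  have gH: "g <#\<^bsub>G\<^esub> H \<subseteq> carrier G"
    using H g by (auto simp: l_coset_def)
  have "g <#\<^bsub>G\<^esub> H #> inv g = H \<longleftrightarrow> g <#\<^bsub>G\<^esub> H = H #> g"
    using coset_mult_assoc[OF gH, of "inv g" g] coset_mult_assoc[OF H, of g "inv g"] g H gH
    by (metis coset_mult_one inv_closed l_inv r_inv)
  then show ?thesis
    using g by (auto simp: set_normalizer_def)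
qed

lemma subgroup_set_normalizer:
  assumes "H \<subseteq> carrier G"
  shows "subgroup (set_normalizer G H) G"
proof -
  have "set_normalizer G H = normalizer G H"
    using assms set_normalizer_iff_conjugate[OF assms]
    by (auto simp: normalizer_def stabilizer_def set_normalizer_def)
  then show ?thesis
    using normalizer_imp_subgroup[OF assms] by simp
qed

lemma set_normalizer_conj_closed:
  assumes H: "H \<subseteq> carrier G" and x: "x \<in> set_normalizer G H" and h: "h \<in> H"
  shows "inv x \<otimes> h \<otimes> x \<in> H"
proof -
  have xG: "x \<in> carrier G" and eq: "H #> x = x <#\<^bsub>G\<^esub> H"
    using x by (auto simp: set_normalizer_def)
  have "h \<otimes> x \<in> x <#\<^bsub>G\<^esub> H"
    using rcosI[OF h H xG] unfolding eq .
  then obtain h' where h': "h' \<in> H" "h \<otimes> x = x \<otimes> h'"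
    by (auto simp: l_coset_def)
  then have "inv x \<otimes> h \<otimes> x = h'"
    using xG h H by (simp add: m_assoc subset_iff inv_solve_left')
  then show ?thesis
    using h'(1) by simp
qed

lemma subgroup_aut_normalizer:
  assumes H: "H \<subseteq> carrier G"
  shows "subgroup (aut_normalizer G H) (BijGroup (carrier G))"
proof (rule group.subgroupI[OF group_BijGroup])
  show "aut_normalizer G H \<subseteq> carrier (BijGroup (carrier G))"
    by (auto simp: aut_normalizer_def auto_def BijGroup_def)
  have "(\<lambda>x \<in> carrier G. x) ` H = H"
    using H by force
  then show "aut_normalizer G H \<noteq> {}"
    using id_in_auto unfolding aut_normalizer_def by blast
next
  fix \<sigma> assume s: "\<sigma> \<in> aut_normalizer G H"
  then have a: "\<sigma> \<in> auto G" and sH: "\<sigma> ` H = H" and b: "\<sigma> \<in> Bij (carrier G)"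
    by (auto simp: aut_normalizer_def auto_def)
  have inj: "inj_on \<sigma> (carrier G)"
    using b by (auto simp: Bij_def bij_betw_def)
  have "(inv\<^bsub>BijGroup (carrier G)\<^esub> \<sigma>) ` H = inv_into (carrier G) \<sigma> ` H"
    using H by (intro image_cong) (auto simp: inv_BijGroup[OF b])
  also have "\<dots> = H"
    using inv_into_image_cancel[OF inj H] sH by simp
  finally show "inv\<^bsub>BijGroup (carrier G)\<^esub> \<sigma> \<in> aut_normalizer G H"
    using subgroup.m_inv_closed[OF subgroup_auto a] by (simp add: aut_normalizer_def)
next
  fix \<sigma> \<tau> assume st: "\<sigma> \<in> aut_normalizer G H" "\<tau> \<in> aut_normalizer G H"
  then have "\<sigma> \<in> Bij (carrier G)" "\<tau> \<in> Bij (carrier G)"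
    by (auto simp: aut_normalizer_def auto_def)
  then have "(\<sigma> \<otimes>\<^bsub>BijGroup (carrier G)\<^esub> \<tau>) ` H = \<sigma> ` \<tau> ` H"
    using H by (auto simp: BijGroup_mult_apply subset_iff image_image intro!: image_cong)
  with st show "\<sigma> \<otimes>\<^bsub>BijGroup (carrier G)\<^esub> \<tau> \<in> aut_normalizer G H"
    using subgroup.m_closed[OF subgroup_auto] by (simp add: aut_normalizer_def)
qed

section \<open>Two-sided translations\<close>

lemma mult_inv_cancel_left:
  "\<lbrakk>a \<in> carrier G; b \<in> carrier G\<rbrakk> \<Longrightarrow> a \<otimes> (inv a \<otimes> b) = b"
  by (simp add: m_assoc[symmetric])

lemma inv_mult_cancel_left:
  "\<lbrakk>a \<in> carrier G; b \<in> carrier G\<rbrakk> \<Longrightarrow> inv a \<otimes> (a \<otimes> b) = b"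
  by (simp add: m_assoc[symmetric])

lemma translation_closed:
  "\<lbrakk>x \<in> carrier G; y \<in> carrier G; g \<in> carrier G\<rbrakk> \<Longrightarrow> translation G x y g \<in> carrier G"
  by (simp add: translation_def)

text \<open>
  Translations act naturally on the right, while \<^const>\<open>compose\<close> applies its second argument first;
  this is why the factors are reversed in both parameters.
\<close>

lemma compose_translation:
  assumes "x \<in> carrier G" "y \<in> carrier G" "x' \<in> carrier G" "y' \<in> carrier G"
  shows "compose (carrier G) (translation G x y) (translation G x' y')
       = translation G (x' \<otimes> x) (y' \<otimes> y)"
  using assms by (auto simp: compose_def translation_def fun_eq_iff inv_mult_group m_assoc)

lemma translation_one: "translation G \<one> \<one> = (\<lambda>g \<in> carrier G. g)"
  by (auto simp: translation_def fun_eq_iff)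

lemma translation_Bij:
  assumes x: "x \<in> carrier G" and y: "y \<in> carrier G"
  shows "translation G x y \<in> Bij (carrier G)"
proof -
  have "bij_betw (translation G x y) (carrier G) (carrier G)"
    by (rule bij_betwI[where g = "translation G (inv x) (inv y)"])
      (use x y in \<open>auto simp: translation_def m_assoc mult_inv_cancel_left inv_mult_cancel_left\<close>)
  then show ?thesis
    by (simp add: Bij_def translation_def)
qed

lemma subgroup_translations:
  assumes X: "subgroup X G" and Y: "subgroup Y G"
  shows "subgroup {translation G x y | x y. x \<in> X \<and> y \<in> Y} (BijGroup (carrier G))"
    (is "subgroup ?T ?B")
proof (rule group.subgroupI[OF group_BijGroup])
  note mem = subgroup.mem_carrier[OF X] subgroup.mem_carrier[OF Y]
  show "?T \<subseteq> carrier ?B"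
    using mem by (auto simp: BijGroup_def intro!: translation_Bij)
  show "?T \<noteq> {}"
    using subgroup.one_closed[OF X] subgroup.one_closed[OF Y] by blast
  have mult: "translation G x y \<otimes>\<^bsub>?B\<^esub> translation G x' y' = translation G (x' \<otimes> x) (y' \<otimes> y)"
    if "x \<in> X" "y \<in> Y" "x' \<in> X" "y' \<in> Y" for x y x' y'
    using that mem by (simp add: BijGroup_def translation_Bij compose_translation)
  show "\<sigma> \<otimes>\<^bsub>?B\<^esub> \<tau> \<in> ?T" if "\<sigma> \<in> ?T" "\<tau> \<in> ?T" for \<sigma> \<tau>
  proof -
    obtain x y x' y' where s: "\<sigma> = translation G x y" "\<tau> = translation G x' y'"
      and xy: "x \<in> X" "y \<in> Y" "x' \<in> X" "y' \<in> Y"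
      using \<open>\<sigma> \<in> ?T\<close> \<open>\<tau> \<in> ?T\<close> by blast
    have "x' \<otimes> x \<in> X" "y' \<otimes> y \<in> Y"
      using subgroup.m_closed[OF X] subgroup.m_closed[OF Y] xy by auto
    then show ?thesis
      unfolding s mult[OF xy] by blast
  qed
  show "inv\<^bsub>?B\<^esub> \<sigma> \<in> ?T" if "\<sigma> \<in> ?T" for \<sigma>
  proof -
    obtain x y where s: "\<sigma> = translation G x y" and x: "x \<in> X" and y: "y \<in> Y"
      using \<open>\<sigma> \<in> ?T\<close> by blast
    note xy' = subgroup.m_inv_closed[OF X x] subgroup.m_inv_closed[OF Y y]
    have "translation G (inv x) (inv y) \<otimes>\<^bsub>?B\<^esub> \<sigma> = \<one>\<^bsub>?B\<^esub>"
      using mult[OF xy' x y] mem x y by (simp add: s translation_one) (simp add: BijGroup_def)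
    then have "inv\<^bsub>?B\<^esub> \<sigma> = translation G (inv x) (inv y)"
      using x y mem
      by (intro group.inv_equality[OF group_BijGroup])
        (simp_all add: s BijGroup_def translation_Bij)
    then show ?thesis
      using xy' by blast
  qed
qed

text \<open>
  Inserting \<open>xx\<inverse>\<close> and \<open>yy\<inverse>\<close> around the vertex replaces the arc's labels by their conjugates.
\<close>

lemma translation_arc:
  assumes "x \<in> carrier G" "y \<in> carrier G" "l \<in> carrier G" "r \<in> carrier G" "u \<in> carrier G"
  shows "translation G x y (inv l \<otimes> u \<otimes> r)
       = inv (inv x \<otimes> l \<otimes> x) \<otimes> translation G x y u \<otimes> (inv y \<otimes> r \<otimes> y)"
  using assms by (simp add: translation_def inv_mult_group m_assoc mult_inv_cancel_left)

text \<open>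
  The image of \<open>\<one>\<close> under such a translation is \<open>x\<inverse>y\<close>, and \<open>x\<inverse>\<close> runs through \<open>X\<close> when \<open>x\<close> does.
\<close>

lemma orbit_one_translations:
  assumes X: "subgroup X G" and Y: "subgroup Y G"
  shows "{translation G x y \<one> | x y. x \<in> X \<and> y \<in> Y} = X <#> Y"
proof -
  have eq: "translation G x y \<one> = inv x \<otimes> y" if "x \<in> X" for x y
    using that subgroup.mem_carrier[OF X] by (simp add: translation_def)
  have "\<exists>x' \<in> X. inv x' = x" if "x \<in> X" for x
    using that subgroup.m_inv_closed[OF X] subgroup.mem_carrier[OF X] inv_inv by blast
  then have "(\<lambda>x. inv x) ` X = X"
    using subgroup.m_inv_closed[OF X] by auto
  moreover have "{translation G x y \<one> | x y. x \<in> X \<and> y \<in> Y}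
               = (\<Union>x \<in> X. \<Union>y \<in> Y. {translation G x y \<one>})"
    by blast
  moreover have "\<dots> = (\<lambda>x. inv x) ` X <#> Y"
    by (simp add: eq set_mult_def)
  ultimately show ?thesis by simp
qed

section \<open>Automorphisms of two-sided Cayley graphs\<close>

lemma subgroup_normalizer_translations:
  assumes L: "L \<subseteq> carrier G" and R: "R \<subseteq> carrier G"
  shows "subgroup (normalizer_translations G L R) (digraph_aut_group (two_sided_cayley G L R))"
proof (rule subgroup_digraph_aut_groupI)
  show "subgroup (normalizer_translations G L R) (BijGroup (pverts (two_sided_cayley G L R)))"
    using subgroup_translations[OF subgroup_set_normalizer[OF L] subgroup_set_normalizer[OF R]]
    by (simp add: normalizer_translations_def two_sided_cayley_def)
next
  fix \<sigma> u v
  assume "\<sigma> \<in> normalizer_translations G L R" and uv: "(u, v) \<in> parcs (two_sided_cayley G L R)"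
  then obtain x y where s: "\<sigma> = translation G x y"
    and x: "x \<in> set_normalizer G L" and y: "y \<in> set_normalizer G R"
    by (auto simp: normalizer_translations_def)
  have xy: "x \<in> carrier G" "y \<in> carrier G"
    using x y by (auto simp: set_normalizer_def)
  obtain l r where l: "l \<in> L" and r: "r \<in> R" and v: "v = inv l \<otimes> u \<otimes> r"
    and u: "u \<in> carrier G" and vG: "v \<in> carrier G"
    using uv by (auto simp: two_sided_cayley_def)
  have "\<sigma> v = inv (inv x \<otimes> l \<otimes> x) \<otimes> \<sigma> u \<otimes> (inv y \<otimes> r \<otimes> y)"
    unfolding s v using xy l r u L R by (intro translation_arc) auto
  moreover have "inv x \<otimes> l \<otimes> x \<in> L" "inv y \<otimes> r \<otimes> y \<in> R"
    using set_normalizer_conj_closed L R x y l r by blast+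
  moreover have "\<sigma> u \<in> carrier G" "\<sigma> v \<in> carrier G"
    unfolding s using xy u vG by (auto intro: translation_closed)
  ultimately show "(\<sigma> u, \<sigma> v) \<in> parcs (two_sided_cayley G L R)"
    unfolding two_sided_cayley_def by auto
qed

lemma subgroup_aut_normalizer_inter:
  assumes L: "L \<subseteq> carrier G" and R: "R \<subseteq> carrier G"
  shows "subgroup (aut_normalizer G L \<inter> aut_normalizer G R)
    (digraph_aut_group (two_sided_cayley G L R))"
proof (rule subgroup_digraph_aut_groupI)
  show "subgroup (aut_normalizer G L \<inter> aut_normalizer G R)
    (BijGroup (pverts (two_sided_cayley G L R)))"
    using group.subgroups_Inter_pair[OF group_BijGroup subgroup_aut_normalizer[OF L]
        subgroup_aut_normalizer[OF R]]
    by (simp add: two_sided_cayley_def)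
next
  fix \<sigma> u v
  assume s: "\<sigma> \<in> aut_normalizer G L \<inter> aut_normalizer G R"
    and uv: "(u, v) \<in> parcs (two_sided_cayley G L R)"
  then have "\<sigma> \<in> hom G G"
    by (auto simp: aut_normalizer_def auto_def)
  then interpret \<sigma>: group_hom G G \<sigma>
    by unfold_locales
  obtain l r where l: "l \<in> L" and r: "r \<in> R" and v: "v = inv l \<otimes> u \<otimes> r"
    and u: "u \<in> carrier G" and vG: "v \<in> carrier G"
    using uv by (auto simp: two_sided_cayley_def)
  have lr: "l \<in> carrier G" "r \<in> carrier G"
    using l r L R by auto
  have "\<sigma> v = inv (\<sigma> l) \<otimes> \<sigma> u \<otimes> \<sigma> r"
    unfolding v using lr u by simp
  moreover have "\<sigma> l \<in> L" "\<sigma> r \<in> R"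
    using s l r by (auto simp: aut_normalizer_def)
  moreover have "\<sigma> u \<in> carrier G" "\<sigma> v \<in> carrier G"
    using u vG by auto
  ultimately show "(\<sigma> u, \<sigma> v) \<in> parcs (two_sided_cayley G L R)"
    unfolding two_sided_cayley_def by auto
qed

lemma normalizer_translations_transitive_iff:
  assumes L: "L \<subseteq> carrier G" and R: "R \<subseteq> carrier G"
  shows "acts_vertex_transitively (normalizer_translations G L R) (two_sided_cayley G L R)
    \<longleftrightarrow> carrier G = set_normalizer G L <#> set_normalizer G R"
proof -
  have V: "pverts (two_sided_cayley G L R) = carrier G"
    by (simp add: two_sided_cayley_def)
  note N = subgroup_set_normalizer[OF L] subgroup_set_normalizer[OF R]
  have orbit: "{\<sigma> \<one> | \<sigma>. \<sigma> \<in> normalizer_translations G L R}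
             = set_normalizer G L <#> set_normalizer G R"
    unfolding orbit_one_translations[OF N, symmetric] normalizer_translations_def by blast
  have "acts_vertex_transitively (normalizer_translations G L R) (two_sided_cayley G L R)
    \<longleftrightarrow> carrier G \<subseteq> {\<sigma> \<one> | \<sigma>. \<sigma> \<in> normalizer_translations G L R}"
    by (subst acts_vertex_transitively_iff_orbit
        [OF subgroup_normalizer_translations[OF L R], of \<one>]) (auto simp: V)
  then show ?thesis
    using setmult_subset_G[OF subgroup.subset[OF N(1)] subgroup.subset[OF N(2)]]
    unfolding orbit by blast
qed

end

theorem proposition5p2:
  fixes G :: "('a, 'b) monoid_scheme" and L R :: "'a set"
  assumes "group G"
    and "L \<subseteq> carrier G" and "L \<noteq> {}"
    and "R \<subseteq> carrier G" and "R \<noteq> {}"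
  shows "subgroup (normalizer_translations G L R) (digraph_aut_group (two_sided_cayley G L R))
    \<and> subgroup (aut_normalizer G L \<inter> aut_normalizer G R)
        (digraph_aut_group (two_sided_cayley G L R))
    \<and> (acts_vertex_transitively (normalizer_translations G L R) (two_sided_cayley G L R)
        \<longleftrightarrow> carrier G = set_normalizer G L <#>\<^bsub>G\<^esub> set_normalizer G R)"
  by (intro conjI group.subgroup_normalizer_translations[OF assms(1,2,4)]
      group.subgroup_aut_normalizer_inter[OF assms(1,2,4)]
      group.normalizer_translations_transitive_iff[OF assms(1,2,4)])

end
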